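(* Let $\mu\ge 3$ be an integer and let $S=(x_1,\ldots,x_n;y_1,\ldots,y_m)$ be a bipartite graphic sequence all of whose elements are greater than $\mu-1$. Then $S$ has a realization (a simple bipartite graph with bipartite degree sequence $S$) that is $\mu$-edge-connected.
   Context: All graphs are finite and simple. For a bipartite graph $G$ with bipartition $(X,Y)$, its bipartite degree sequence is $(x_1,\ldots,x_n;y_1,\ldots,y_m)$ where $x_1,\ldots,x_n$ are the degrees of the vertices of $X$ and $y_1,\ldots,y_m$ those of the vertices of $Y$. A sequence of positive integers of this form is a bipartite graphic sequence if some bipartite graph has it as bipartite degree sequence; such a graph is a realization of the sequence. For a nonempty proper subset $S\subset V(G)$, the edge cut $[S,\overline S]$ is the set of edges with one end in $S$ and the other in $V(G)\setminus S$. The edge connectivity $\kappa'(G)$ is the minimum size of an edge cut, and $G$ is $k$-edge-connected if $\kappa'(G)\ge k$. *)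

theory Defs
  imports "HOL-Library.Multiset"
begin

text \<open>A graph is a vertex set \<open>V\<close> together with a set \<open>E\<close> of two-element subsets of \<open>V\<close>.\<close>

definition simple_graph :: "'a set \<Rightarrow> 'a set set \<Rightarrow> bool" where
  "simple_graph V E \<longleftrightarrow> finite V \<and> (\<forall>e\<in>E. e \<subseteq> V \<and> card e = 2)"

definition degree :: "'a set set \<Rightarrow> 'a \<Rightarrow> nat" where
  "degree E v = card {e \<in> E. v \<in> e}"

definition bipartition :: "'a set \<Rightarrow> 'a set set \<Rightarrow> 'a set \<Rightarrow> 'a set \<Rightarrow> bool" where
  "bipartition V E X Y \<longleftrightarrow>
     X \<union> Y = V \<and> X \<inter> Y = {} \<and> (\<forall>e\<in>E. \<exists>x\<in>X. \<exists>y\<in>Y. e = {x, y})"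

text \<open>
  The degree sequence of a graph depends on an enumeration of the vertices; so \<open>xs\<close> and \<open>ys\<close>
  are compared as multisets with the degrees in \<open>X\<close> and in \<open>Y\<close>.
\<close>

definition bipartite_degree_sequence ::
    "'a set set \<Rightarrow> 'a set \<Rightarrow> 'a set \<Rightarrow> nat list \<Rightarrow> nat list \<Rightarrow> bool" where
  "bipartite_degree_sequence E X Y xs ys \<longleftrightarrow>
     mset xs = image_mset (degree E) (mset_set X) \<and>
     mset ys = image_mset (degree E) (mset_set Y)"

definition realization :: "'a set \<Rightarrow> 'a set set \<Rightarrow> nat list \<Rightarrow> nat list \<Rightarrow> bool" where
  "realization V E xs ys \<longleftrightarrow>
     simple_graph V E \<and>
     (\<exists>X Y. bipartition V E X Y \<and> bipartite_degree_sequence E X Y xs ys)"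

text \<open>
  A sequence \<open>(x\<^sub>1, \<dots>, x\<^sub>n; y\<^sub>1, \<dots>, y\<^sub>m)\<close> has \<open>n, m \<ge> 1\<close>, hence the two
  nonemptiness conditions. Every finite graph is isomorphic to one whose vertices are natural
  numbers, so it suffices to quantify over graphs on \<^typ>\<open>nat\<close>.
\<close>

definition bipartite_graphic :: "nat list \<Rightarrow> nat list \<Rightarrow> bool" where
  "bipartite_graphic xs ys \<longleftrightarrow>
     xs \<noteq> [] \<and> ys \<noteq> [] \<and> (\<forall>d \<in> set xs \<union> set ys. d > 0) \<and>
     (\<exists>(V :: nat set) E. realization V E xs ys)"

definition edge_cut :: "'a set \<Rightarrow> 'a set set \<Rightarrow> 'a set \<Rightarrow> 'a set set" where
  "edge_cut V E S = {e \<in> E. \<exists>u\<in>S. \<exists>v\<in>V - S. e = {u, v}}"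

text \<open>
  A graph with fewer than two vertices has no edge cut; its edge connectivity is then
  \<open>Inf {} = 0\<close>. Otherwise the infimum is a minimum, being taken over a nonempty set of
  natural numbers.
\<close>

definition edge_connectivity :: "'a set \<Rightarrow> 'a set set \<Rightarrow> nat" where
  "edge_connectivity V E = (INF S \<in> {S. S \<noteq> {} \<and> S \<subset> V}. card (edge_cut V E S))"

definition edge_connected :: "nat \<Rightarrow> 'a set \<Rightarrow> 'a set set \<Rightarrow> bool" where
  "edge_connected k V E \<longleftrightarrow> edge_connectivity V E \<ge> k"

end

theory Submission
  imports Defs
begin

text \<open>
  Among the realizations with all cuts of size at least \<open>k < \<mu>\<close>, the number of cuts of size exactly
  \<open>k\<close> can always be decreased by a switch. Let \<open>S\<close> be an inclusion-minimal side of a cut of size \<open>k\<close>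
  and \<open>T\<close> another one disjoint from it. Minimality gives \<open>2 e(C, S - C) \<ge> k + 2\<close> for each nontrivial
  \<open>C \<subset> S\<close>, and likewise for \<open>T\<close>. Uncrossing the sets \<open>C\<close> that attain equality shows that some edge
  \<open>xy\<close> inside \<open>S\<close>, with no edge from \<open>x\<close> or \<open>y\<close> leaving \<open>S\<close>, is split by none of them. For any edge
  \<open>uv\<close> inside \<open>T\<close>, replace \<open>xy\<close> and \<open>uv\<close> by \<open>xv\<close> and \<open>uy\<close>. The cut of \<open>S\<close> grows by 2, and only
  cuts separating \<open>{x, v}\<close> from \<open>{u, y}\<close> shrink, each by 2; those had size at least \<open>k + 3\<close>.
\<close>

section \<open>Counting edges between vertex sets\<close>

definition edges_between :: "'a set set \<Rightarrow> 'a set \<Rightarrow> 'a set \<Rightarrow> 'a set set" where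
  "edges_between E P Q = {e \<in> E. \<exists>u\<in>P. \<exists>v\<in>Q. e = {u, v}}"

lemma edge_cut_eq: "edge_cut V E S = edges_between E S (V - S)"
  by (simp add: edge_cut_def edges_between_def)

abbreviation num_between :: "'a set set \<Rightarrow> 'a set \<Rightarrow> 'a set \<Rightarrow> nat" where
  "num_between E P Q \<equiv> card (edges_between E P Q)"

lemma simple_graph_finite: "simple_graph V E \<Longrightarrow> finite V \<and> finite E"
  unfolding simple_graph_def by (meson Pow_iff finite_Pow_iff finite_subset subsetI)

lemma edges_between_commute: "edges_between E P Q = edges_between E Q P"
  unfolding edges_between_def by (auto simp: insert_commute)

text \<open>Edges are unordered, so one could be counted twice with the roles of its ends exchanged;
  disjointness from \<open>Q\<close> excludes this, just as \<open>P \<inter> P' = {}\<close>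
  excludes a common end in \<open>P\<close> and \<open>P'\<close>.\<close>

lemma num_between_Un:
  assumes "finite E" "P \<inter> P' = {}" "P \<inter> Q = {}" "P' \<inter> Q = {}"
  shows "num_between E (P \<union> P') Q = num_between E P Q + num_between E P' Q"
    and "num_between E Q (P \<union> P') = num_between E Q P + num_between E Q P'"
proof -
  have 1: "edges_between E (P \<union> P') Q = edges_between E P Q \<union> edges_between E P' Q"
    unfolding edges_between_def by blast
  have 2: "edges_between E P Q \<inter> edges_between E P' Q = {}"
    using assms unfolding edges_between_def by (auto simp: doubleton_eq_iff)
  have 3: "finite (edges_between E P Q)" "finite (edges_between E P' Q)"
    using assms(1) by (auto simp: edges_between_def)
  show "num_between E (P \<union> P') Q = num_between E P Q + num_between E P' Q"
    using 1 2 3 by (simp add: card_Un_disjoint)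
  then show "num_between E Q (P \<union> P') = num_between E Q P + num_between E Q P'"
    by (metis edges_between_commute)
qed

lemma num_between_empty [simp]: "num_between E {} Q = 0" "num_between E Q {} = 0"
  by (simp_all add: edges_between_def)

lemma num_between_mono:
  "finite E \<Longrightarrow> P \<subseteq> P' \<Longrightarrow> Q \<subseteq> Q' \<Longrightarrow> num_between E P Q \<le> num_between E P' Q'"
  by (rule card_mono) (auto simp: edges_between_def)

lemma num_between_sum:
  assumes "finite E" "finite P" "P \<inter> Q = {}"
  shows "num_between E P Q = (\<Sum>v\<in>P. num_between E {v} Q)"
  using assms(2,3)
proof (induction P rule: finite_induct)
  case (insert v P)
  then have "num_between E ({v} \<union> P) Q = num_between E {v} Q + num_between E P Q"
    using assms(1) by (intro num_between_Un) auto
  with insert show ?case by simp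
qed simp

lemma num_between_le_card:
  assumes "finite N" "\<And>w. w \<in> Q \<Longrightarrow> {v, w} \<in> E \<Longrightarrow> w \<in> N"
  shows "num_between E {v} Q \<le> card N"
proof -
  have "edges_between E {v} Q \<subseteq> (\<lambda>w. {v, w}) ` N"
    using assms(2) by (auto simp: edges_between_def)
  then have "num_between E {v} Q \<le> card ((\<lambda>w. {v, w}) ` N)"
    using assms(1) by (intro card_mono) auto
  also have "\<dots> \<le> card N"
    using assms(1) by (rule card_image_le)
  finally show ?thesis .
qed

lemma degree_eq_num_between:
  assumes "simple_graph V E"
  shows "degree E v = num_between E {v} (V - {v})"
proof -
  have "\<exists>w\<in>V - {v}. e = {v, w}" if "e \<in> E" "v \<in> e" for e
  proof -
    have "card e = 2" "e \<subseteq> V" using assms that(1) by (simp_all add: simple_graph_def)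
    then obtain a b where "e = {a, b}" "a \<noteq> b" "a \<in> V" "b \<in> V" by (auto simp: card_2_iff)
    then show ?thesis using that(2) by (auto simp: insert_commute)
  qed
  then have "{e \<in> E. v \<in> e} = edges_between E {v} (V - {v})"
    unfolding edges_between_def by blast
  then show ?thesis by (simp add: degree_def)
qed

lemma degree_split:
  assumes G: "simple_graph V E" and "v \<in> B" "B \<subseteq> V"
  shows "degree E v = num_between E {v} (B - {v}) + num_between E {v} (V - B)"
proof -
  have "V - {v} = (B - {v}) \<union> (V - B)" using assms by auto
  then show ?thesis
    unfolding degree_eq_num_between[OF G]
    using simple_graph_finite[OF G] assms(2) by (simp add: num_between_Un(2) Diff_Int_distrib2)
qed

lemma cut_split:
  assumes G: "simple_graph V E" and "C \<subseteq> S" "S \<subseteq> V"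
  shows "num_between E C (V - C) = num_between E C (S - C) + num_between E C (V - S)"
    and "num_between E S (V - S) = num_between E C (V - S) + num_between E (S - C) (V - S)"
proof -
  have F: "finite E" using simple_graph_finite[OF G] by simp
  have "V - C = (S - C) \<union> (V - S)" using assms by auto
  then show "num_between E C (V - C) = num_between E C (S - C) + num_between E C (V - S)"
    using num_between_Un(2)[OF F, of "S - C" "V - S" C] assms by auto
  have "S = C \<union> (S - C)" using assms by auto
  then show "num_between E S (V - S) = num_between E C (V - S) + num_between E (S - C) (V - S)"
    using num_between_Un(1)[OF F, of C "S - C" "V - S"] assms by auto
qed

text \<open>An edge leaving \<open>S\<close> lies in exactly one of the two cuts on the left, an
  edge between \<open>C\<close> and \<open>S - C\<close> in both.\<close>

lemma cut_add_cut:
  assumes G: "simple_graph V E" and "C \<subseteq> S" "S \<subseteq> V"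
  shows "num_between E C (V - C) + num_between E (S - C) (V - (S - C)) =
    num_between E S (V - S) + 2 * num_between E C (S - C)"
  using cut_split[OF assms] cut_split[OF G, of "S - C" S] assms
  by (simp add: double_diff edges_between_commute[of E "S - C" C])

section \<open>Small cuts and interior edges\<close>

text \<open>With \<open>n = card B\<close>, a vertex of \<open>B\<close> has at most
  \<open>n - 1\<close> neighbours in \<open>B\<close>, so at least
  \<open>n * (\<delta> + 1 - n)\<close> edges leave \<open>B\<close>. This exceeds \<delta> by
  \<open>(n - 1) * (\<delta> - n)\<close>, which is positive for
  \<open>2 \<le> n < \<delta>\<close>.\<close>

lemma card_ge_min_degree:
  assumes G: "simple_graph V E" and B: "B \<subseteq> V" "2 \<le> card B"
    and deg: "\<forall>v\<in>V. \<delta> \<le> degree E v"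
    and cut: "num_between E B (V - B) \<le> \<delta>"
  shows "\<delta> \<le> card B"
proof (rule ccontr)
  assume n: "\<not> \<delta> \<le> card B"
  have fin: "finite V" "finite E" "finite B"
    using simple_graph_finite[OF G] B(1) finite_subset[of B V] by auto
  have "\<delta> + 1 - card B \<le> num_between E {v} (V - B)" if v: "v \<in> B" for v
  proof -
    have "num_between E {v} (B - {v}) \<le> card (B - {v})"
      using fin by (intro num_between_le_card) auto
    moreover have "card (B - {v}) = card B - 1" using v fin by simp
    moreover have "\<delta> \<le> degree E v" using deg v B by auto
    ultimately show ?thesis using degree_split[OF G v B(1)] B(2) by linarith
  qed
  then have "card B * (\<delta> + 1 - card B) \<le> (\<Sum>v\<in>B. num_between E {v} (V - B))"
    using sum_bounded_below[of B "\<delta> + 1 - card B"] by simp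
  also have "\<dots> = num_between E B (V - B)"
    using fin by (intro num_between_sum[symmetric]) auto
  finally have 1: "card B * (\<delta> + 1 - card B) \<le> \<delta>" using cut by simp
  \<comment> \<open>These substitutions remove truncated subtraction: the bound becomes
    \<open>(a + 2) * (b + 2) \<le> a + b + 3\<close>.\<close>
  obtain a where a: "card B = a + 2" using B(2) by (metis add.commute le_Suc_ex)
  obtain b where b: "\<delta> = card B + b + 1" using n by (metis add.commute add_Suc_right less_natE not_le plus_1_eq_Suc)
  show False using 1 unfolding b a by (simp add: algebra_simps)
qed

text \<open>At most \<open>p\<close> vertices of \<open>B\<close> have an edge out of
  \<open>S\<close>. If no edge joins two of the others, each of these has at most \<open>p\<close>
  neighbours in \<open>B\<close>, hence at least \<open>\<delta> - p\<close> in
  \<open>S - B\<close>. As \<open>\<delta> \<le> card B\<close>, there are at least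
  \<open>\<delta> - p\<close> of them, so \<open>q\<close> would be at least
  \<open>(\<delta> - p) ^ 2\<close>.\<close>

lemma interior_edge:
  assumes G: "simple_graph V E" and B: "B \<subseteq> S" "S \<subseteq> V" "2 \<le> card B"
    and deg: "\<forall>v\<in>V. \<delta> \<le> degree E v"
    and p: "p = num_between E B (V - S)" and q: "q = num_between E B (S - B)"
    and pq: "p + q \<le> \<delta>" "p < \<delta>" "q < (\<delta> - p) ^ 2"
  obtains x y where "x \<in> B" "y \<in> B" "{x, y} \<in> E"
    "num_between E {x} (V - S) = 0" "num_between E {y} (V - S) = 0"
proof (rule ccontr)
  note edge = that
  assume neg: "\<not> thesis"
  have fin: "finite V" "finite E" "finite B"
    using simple_graph_finite[OF G] B finite_subset[of B V] by auto
  have BV: "B \<subseteq> V" using B by auto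
  have "num_between E B (V - B) \<le> \<delta>"
    using cut_split(1)[OF G B(1,2)] p q pq by simp
  then have n: "\<delta> \<le> card B"
    using card_ge_min_degree[OF G BV B(3) deg] by simp
  define W where "W = {w \<in> B. num_between E {w} (V - S) \<noteq> 0}"
  have W: "W \<subseteq> B" "finite W" using fin by (auto simp: W_def)
  have "card W \<le> (\<Sum>w\<in>W. num_between E {w} (V - S))"
    using sum_bounded_below[of W 1 "\<lambda>w. num_between E {w} (V - S)"] by (auto simp: W_def)
  also have "\<dots> \<le> (\<Sum>w\<in>B. num_between E {w} (V - S))"
    using fin W by (intro sum_mono2) auto
  also have "\<dots> = p"
    unfolding p using fin B by (intro num_between_sum[symmetric]) auto
  finally have Wp: "card W \<le> p" .
  have "\<delta> - p \<le> num_between E {x} (S - B)" if x: "x \<in> B - W" for x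
  proof -
    have "num_between E {x} (B - {x}) \<le> card W"
      using neg edge x W by (intro num_between_le_card) (auto simp: W_def)
    moreover have "num_between E {x} (V - B) = num_between E {x} (S - B) + num_between E {x} (V - S)"
    proof -
      have "V - B = (S - B) \<union> (V - S)" using B by auto
      then show ?thesis using num_between_Un(2)[OF fin(2), of "S - B" "V - S" "{x}"] B x by auto
    qed
    moreover have "num_between E {x} (V - S) = 0" using x by (auto simp: W_def)
    moreover have "\<delta> \<le> degree E x" using deg x BV by auto
    ultimately show ?thesis using degree_split[OF G _ BV, of x] x Wp by auto
  qed
  then have "card (B - W) * (\<delta> - p) \<le> (\<Sum>x\<in>B - W. num_between E {x} (S - B))"
    using sum_bounded_below[of "B - W" "\<delta> - p"] by simp
  also have "\<dots> \<le> (\<Sum>x\<in>B. num_between E {x} (S - B))"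
    using fin by (intro sum_mono2) auto
  also have "\<dots> = q"
    unfolding q using fin by (intro num_between_sum[symmetric]) auto
  finally have "card (B - W) * (\<delta> - p) \<le> q" .
  moreover have "\<delta> - p \<le> card (B - W)"
    using n Wp W by (simp add: card_Diff_subset)
  then have "(\<delta> - p) * (\<delta> - p) \<le> card (B - W) * (\<delta> - p)" by (rule mult_le_mono1)
  ultimately show False using pq(3) unfolding power2_eq_square by linarith
qed

section \<open>Minimal sides of tight cuts\<close>

text \<open>The strict inequality combines minimality with the absence of smaller cuts inside
  \<open>S\<close>, so facts about an atom can be proved without a bound on the other cuts of the
  graph.\<close>

definition atom :: "'a set \<Rightarrow> 'a set set \<Rightarrow> nat \<Rightarrow> 'a set \<Rightarrow> bool" where
  "atom V E k S \<longleftrightarrow> S \<noteq> {} \<and> S \<subset> V \<and> num_between E S (V - S) = k \<and>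
     (\<forall>C. C \<noteq> {} \<longrightarrow> C \<subset> S \<longrightarrow> k < num_between E C (V - C))"

text \<open>In an inclusion-minimal side of size \<open>k\<close>, proper subsets have cuts of size
  other than \<open>k\<close>, hence larger by \<open>conn\<close>. Confining the atom to a given
  \<open>A\<close> later yields two disjoint atoms.\<close>

lemma atom_exists:
  assumes G: "simple_graph V E"
    and conn: "\<And>A. A \<noteq> {} \<Longrightarrow> A \<subset> V \<Longrightarrow> k \<le> num_between E A (V - A)"
    and A: "A \<noteq> {}" "A \<subset> V" "num_between E A (V - A) = k"
  obtains S where "S \<subseteq> A" "atom V E k S"
proof -
  let ?F = "{S. S \<noteq> {} \<and> S \<subset> V \<and> num_between E S (V - S) = k}"
  have "finite ?F"
    by (rule finite_subset[of _ "Pow V"]) (use simple_graph_finite[OF G] in auto)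
  moreover have "A \<in> ?F" using A by auto
  ultimately have "\<exists>S\<in>?F. S \<subseteq> A \<and> (\<forall>C\<in>?F. C \<subseteq> S \<longrightarrow> S = C)"
    by (rule finite_has_minimal2)
  then obtain S where S: "S \<in> ?F" "S \<subseteq> A" "\<forall>C\<in>?F. C \<subseteq> S \<longrightarrow> S = C"
    by blast
  have S1: "S \<noteq> {}" "S \<subset> V" "num_between E S (V - S) = k" using S(1) by simp_all
  have "k < num_between E C (V - C)" if C: "C \<noteq> {}" "C \<subset> S" for C
  proof (rule ccontr)
    assume "\<not> ?thesis"
    moreover have "C \<subset> V" using C(2) S1(2) by (rule psubset_trans)
    ultimately have "C \<in> ?F" using conn[OF C(1)] C(1) by simp
    then have "S = C" using S(3) C(2) by (meson psubset_imp_subset)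
    then show False using C(2) by simp
  qed
  then have "atom V E k S" using S1 unfolding atom_def by simp
  then show ?thesis using that[OF S(2)] by simp
qed

text \<open>\<open>C\<close> and \<open>S - C\<close> both have cuts of size at least
  \<open>k + 1\<close>, and by \<open>cut_add_cut\<close> these sizes add up to
  \<open>k + 2 * num_between E C (S - C)\<close>.\<close>

lemma atom_split:
  assumes G: "simple_graph V E" and S: "atom V E k S" and C: "C \<noteq> {}" "C \<subset> S"
  shows "k + 2 \<le> 2 * num_between E C (S - C)"
proof -
  have S': "S \<subseteq> V" "num_between E S (V - S) = k"
    "\<And>D. D \<noteq> {} \<Longrightarrow> D \<subset> S \<Longrightarrow> k < num_between E D (V - D)"
    using S by (auto simp: atom_def)
  have "S - C \<noteq> {}" "S - C \<subset> S" using C by auto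
  then show ?thesis
    using S'(3)[OF C] S'(3)[of "S - C"] S'(2) cut_add_cut[OF G psubset_imp_subset[OF C(2)] S'(1)]
    by linarith
qed

text \<open>Uncrossing: if the four corners \<open>P\<close>, \<open>Q\<close>, \<open>R\<close>,
  \<open>Z\<close> were all nonempty, each would have a cut larger than \<open>k\<close>, which
  takes more edges than two tight splits provide.\<close>

lemma tight_splits_cross:
  assumes G: "simple_graph V E" and S: "atom V E k S"
    and B: "B \<subseteq> S" "2 * num_between E B (S - B) \<le> k + 2"
    and C: "C \<subseteq> S" "2 * num_between E C (S - C) \<le> k + 2"
  shows "B \<inter> C = {} \<or> B - C = {} \<or> C - B = {} \<or> S - (B \<union> C) = {}"
proof (rule ccontr)
  assume neg: "\<not> ?thesis"
  define P Q R Z W where defs: "P = B \<inter> C" "Q = B - C" "R = C - B" "Z = S - (B \<union> C)" "W = V - S"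
  have F: "finite E" using simple_graph_finite[OF G] by simp
  have SV: "S \<subseteq> V" using S by (auto simp: atom_def)
  have disj: "P \<inter> Q = {}" "P \<inter> R = {}" "P \<inter> Z = {}" "P \<inter> W = {}" "Q \<inter> R = {}" "Q \<inter> Z = {}"
    "Q \<inter> W = {}" "R \<inter> Z = {}" "R \<inter> W = {}" "Z \<inter> W = {}"
    unfolding defs using B C SV by auto
  note disj' = disj[THEN trans[OF Int_commute]]
  have "num_between E P (V - P) > k" "num_between E Q (V - Q) > k"
    "num_between E R (V - R) > k" "num_between E Z (V - Z) > k"
  proof -
    have "\<And>D. D \<noteq> {} \<Longrightarrow> D \<subset> S \<Longrightarrow> k < num_between E D (V - D)"
      using S by (auto simp: atom_def)
    moreover have "P \<noteq> {}" "Q \<noteq> {}" "R \<noteq> {}" "Z \<noteq> {}" using neg by (auto simp: defs)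
    moreover have "P \<subset> S" "Q \<subset> S" "R \<subset> S" "Z \<subset> S" using neg B C by (auto simp: defs)
    ultimately show "num_between E P (V - P) > k" "num_between E Q (V - Q) > k"
      "num_between E R (V - R) > k" "num_between E Z (V - Z) > k" by blast+
  qed
  moreover have "V - P = Q \<union> (R \<union> (Z \<union> W))" "V - Q = P \<union> (R \<union> (Z \<union> W))"
    "V - R = P \<union> (Q \<union> (Z \<union> W))" "V - Z = P \<union> (Q \<union> (R \<union> W))"
    unfolding defs using B C SV by auto
  moreover have "num_between E S (V - S) = k" using S by (simp add: atom_def)
  moreover have "S = P \<union> (Q \<union> (R \<union> Z))" "V - S = W" "B = P \<union> Q" "S - B = R \<union> Z" "C = P \<union> R" "S - C = Q \<union> Z"
    unfolding defs using B C SV by auto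
  moreover note B(2) C(2)
  ultimately have *:
    "num_between E P (Q \<union> (R \<union> (Z \<union> W))) > k" "num_between E Q (P \<union> (R \<union> (Z \<union> W))) > k"
    "num_between E R (P \<union> (Q \<union> (Z \<union> W))) > k" "num_between E Z (P \<union> (Q \<union> (R \<union> W))) > k"
    "num_between E (P \<union> (Q \<union> (R \<union> Z))) W = k"
    "2 * num_between E (P \<union> Q) (R \<union> Z) \<le> k + 2" "2 * num_between E (P \<union> R) (Q \<union> Z) \<le> k + 2"
    by simp_all
  \<comment> \<open>Expands every count into counts between two of the five blocks, with the
    commutativity instances fixing one order for each pair of corners.\<close>
  note un = num_between_Un[OF F] Int_Un_distrib Int_Un_distrib2 disj disj' Un_empty_left
    edges_between_commute[of E Q P] edges_between_commute[of E R P]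
    edges_between_commute[of E Z P] edges_between_commute[of E R Q]
    edges_between_commute[of E Z Q] edges_between_commute[of E Z R]
  note ineq = *[simplified un simp_thms add_mult_distrib2]
  \<comment> \<open>The corner cuts sum to \<open>k\<close> plus twice the edges between corners.
    The two split bounds add up to at least that second term, so
    \<open>4 * (k + 1) \<le> k + (2 * k + 4)\<close>.\<close>
  have k: "k = 0" using ineq by linarith
  note out = ineq(5)[unfolded k add_is_0]
  \<comment> \<open>Now no edge leaves \<open>S\<close>, each corner has an edge to another corner,
    and each split has at most one edge. Without a \<open>P\<close>-\<open>R\<close> edge,
    \<open>P\<close> and \<open>R\<close> each need an edge across the split of \<open>C\<close>.
    With one, it exhausts the split of \<open>B\<close>, so \<open>P\<close>-\<open>Q\<close> and
    \<open>R\<close>-\<open>Z\<close> edges are forced. Either way the split of \<open>C\<close> has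
    two edges.\<close>
  show False
  proof (cases "num_between E P R = 0")
    case True
    then show False using ineq(1,3,7) out unfolding k by simp
  next
    case False
    then have "num_between E P Z = 0" "num_between E Q R = 0" "num_between E Q Z = 0"
      using ineq(6) unfolding k by simp_all
    then show False using ineq(2,4,7) out unfolding k by simp
  qed
qed

text \<open>The edge is taken inside a minimal tight set \<open>B\<close> with at least two
  vertices. A tight split separating its ends cannot cross \<open>B\<close>, so one of its sides
  lies properly inside \<open>B\<close>; by minimality that side is a single interior vertex, whose
  degree is too large for a tight split.\<close>

lemma atom_edge:
  assumes G: "simple_graph V E" and S: "atom V E k S"
    and deg: "\<forall>v\<in>V. \<delta> \<le> degree E v" and k: "k < \<delta>" "2 \<le> \<delta>"
  obtains x y where "x \<in> S" "y \<in> S" "{x, y} \<in> E"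
    "num_between E {x} (V - S) = 0" "num_between E {y} (V - S) = 0"
    "\<And>C. C \<subseteq> S \<Longrightarrow> (x \<in> C) \<noteq> (y \<in> C) \<Longrightarrow> k + 3 \<le> 2 * num_between E C (S - C)"
proof -
  have SV: "S \<subseteq> V" "S \<noteq> {}" and cutS: "num_between E S (V - S) = k"
    and minS: "\<And>C. C \<noteq> {} \<Longrightarrow> C \<subset> S \<Longrightarrow> k < num_between E C (V - C)"
    using S by (auto simp: atom_def)
  have fin: "finite E" "finite S"
    using simple_graph_finite[OF G] SV finite_subset by auto
  have "card S \<noteq> 1"
  proof
    assume "card S = 1"
    then obtain s where s: "S = {s}" by (auto simp: card_1_singleton_iff)
    then have "degree E s = k" using cutS degree_eq_num_between[OF G] by simp
    then show False using deg s SV k by auto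
  qed
  then have card_S: "2 \<le> card S"
    using SV(2) fin(2) card_gt_0_iff[of S] by linarith
  \<comment> \<open>\<open>B = S\<close> satisfies the bound on \<open>e(B, S - B)\<close> trivially, so a minimal such \<open>B\<close> exists even when no
    proper subset is tight. Singletons are excluded because the edge is to be found inside \<open>B\<close>.\<close>
  let ?F = "{B. B \<subseteq> S \<and> 2 \<le> card B \<and> 2 * num_between E B (S - B) \<le> k + 2}"
  have "finite ?F" by (rule finite_subset[of _ "Pow S"]) (use fin in auto)
  moreover have "S \<in> ?F" using card_S by simp
  ultimately have "\<exists>B\<in>?F. B \<subseteq> S \<and> (\<forall>C\<in>?F. C \<subseteq> B \<longrightarrow> B = C)"
    by (rule finite_has_minimal2)
  then obtain B where B: "B \<in> ?F" "\<forall>C\<in>?F. C \<subseteq> B \<longrightarrow> B = C"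
    by blast
  have BS: "B \<subseteq> S" "2 \<le> card B" "2 * num_between E B (S - B) \<le> k + 2" using B(1) by auto
  define p q where pq: "p = num_between E B (V - S)" "q = num_between E B (S - B)"
  \<comment> \<open>If \<open>B = S\<close>, then \<open>p = k\<close> and \<open>q = 0\<close>.
    Otherwise \<open>2 * q = k + 2\<close>, and the cuts of \<open>B\<close> and
    \<open>S - B\<close>, both larger than \<open>k\<close>, force the \<open>k\<close> edges
    leaving \<open>S\<close> to be shared equally. Hence \<open>p = q - 1\<close> and
    \<open>p + q = k + 1 \<le> \<delta>\<close>.\<close>
  have "p + q \<le> \<delta> \<and> p < \<delta> \<and> q < (\<delta> - p) ^ 2"
  proof (cases "B = S")
    case True
    then show ?thesis using pq cutS k by simp
  next
    case False
    have "B \<noteq> {}" using BS(2) by auto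
    with False have 1: "B \<noteq> {}" "B \<subset> S" "S - B \<noteq> {}" "S - B \<subset> S" using BS(1) by auto
    have q: "2 * q = k + 2"
      using atom_split[OF G S 1(1,2)] BS(3) pq(2) by simp
    have "k < q + p" using minS[OF 1(1,2)] cut_split(1)[OF G BS(1) SV(1)] pq by simp
    moreover have "k < q + num_between E (S - B) (V - S)"
      using minS[OF 1(3,4)] cut_split(1)[OF G _ SV(1), of "S - B"] BS(1) pq
      by (simp add: double_diff edges_between_commute[of E "S - B" B])
    moreover have "k = p + num_between E (S - B) (V - S)"
      using cut_split(2)[OF G BS(1) SV(1)] cutS pq by simp
    ultimately have p: "2 * p = k" "q = p + 1" using q by linarith+
    define m where "m = \<delta> - p"
    have m: "q \<le> m" "2 \<le> m" using p k by (auto simp: m_def)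
    have "m < m ^ 2" using m(2) by (simp add: power2_eq_square)
    then have "q < (\<delta> - p) ^ 2" using m(1) by (simp add: m_def)
    then show ?thesis using p k by auto
  qed
  then obtain x y where xy: "x \<in> B" "y \<in> B" "{x, y} \<in> E"
    "num_between E {x} (V - S) = 0" "num_between E {y} (V - S) = 0"
    using interior_edge[OF G BS(1) SV(1) BS(2) deg pq] by metis
  \<comment> \<open>All of the at least \<delta> edges at \<open>z\<close> stay in \<open>S\<close>.
    The bound \<open>k + 3 \<le> 2 * \<delta>\<close> follows from \<open>k < \<delta>\<close> for
    positive \<open>k\<close> and from \<open>2 \<le> \<delta>\<close> for
    \<open>k = 0\<close>.\<close>
  have single: "k + 3 \<le> 2 * num_between E {z} (S - {z})"
    if "z \<in> B" "num_between E {z} (V - S) = 0" for z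
  proof -
    have "\<delta> \<le> degree E z" using deg that BS SV by auto
    then show ?thesis using degree_split[OF G _ SV(1), of z] that BS k by auto
  qed
  have small: "k + 3 \<le> 2 * num_between E D (S - D)"
    if D: "D \<subset> B" "z \<in> D" "num_between E {z} (V - S) = 0" for D z
  proof (rule ccontr)
    assume neg: "\<not> ?thesis"
    have "D \<notin> ?F" "D \<subseteq> S" "z \<in> B" using B(2) D BS(1) by blast+
    then have "card D \<le> Suc 0" using neg by simp
    moreover have "finite D" using \<open>D \<subseteq> S\<close> fin(2) by (rule finite_subset)
    ultimately have "D = {z}" using D(2) card_le_Suc0_iff_eq[of D] by auto
    then show False using single[OF \<open>z \<in> B\<close> D(3)] neg by simp
  qed
  have split: "k + 3 \<le> 2 * num_between E C (S - C)"
    if C: "C \<subseteq> S" and st: "s \<in> C" "t \<notin> C" "s \<in> B" "t \<in> B"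
      "num_between E {s} (V - S) = 0" "num_between E {t} (V - S) = 0" for C s t
  proof (rule ccontr)
    assume neg: "\<not> ?thesis"
    \<comment> \<open>\<open>s\<close> lies in \<open>B \<inter> C\<close> and \<open>t\<close> in
      \<open>B - C\<close>, so only two of the four empty corners remain possible.\<close>
    then have "C - B = {} \<or> S - (B \<union> C) = {}"
      using tight_splits_cross[OF G S BS(1,3) C] st by auto
    then show False
    proof
      assume "C - B = {}"
      then have "C \<subset> B" using st by auto
      then show False using small[of C s] st neg by simp
    next
      assume "S - (B \<union> C) = {}"
      then have "S - C \<subset> B" "t \<in> S - C" using st BS(1) by auto
      then show False
        using small[of "S - C" t] st neg C by (simp add: double_diff edges_between_commute[of E "S - C" C])
    qed
  qed
  have "k + 3 \<le> 2 * num_between E C (S - C)" if "C \<subseteq> S" "(x \<in> C) \<noteq> (y \<in> C)" for C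
  proof (cases "x \<in> C")
    case True
    then show ?thesis using split[OF that(1), of x y] that(2) xy by simp
  next
    case False
    then show ?thesis using split[OF that(1), of y x] that(2) xy by simp
  qed
  moreover have "x \<in> S" "y \<in> S" using xy BS(1) by auto
  ultimately show ?thesis using that[of x y] xy(3-5) by simp
qed

section \<open>The switch\<close>

text \<open>The predicate is arbitrary so that the same count serves for degrees and for cuts; the
  additive form avoids truncated subtraction.\<close>

lemma card_exchange:
  assumes "finite E" "a \<in> E" "b \<in> E" "c \<notin> E" "d \<notin> E" "a \<noteq> b" "c \<noteq> d"
  shows "card {e \<in> (E - {a, b}) \<union> {c, d}. P e} + of_bool (P a) + of_bool (P b) =
    card {e \<in> E. P e} + of_bool (P c) + of_bool (P d)"
proof -
  let ?f = "\<lambda>e. of_bool (P e) :: nat"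
  let ?D = "E - {a, b}"
  have c: "card {e \<in> F. P e} = sum ?f F" if "finite F" for F
    unfolding card_eq_sum sum.inter_filter[OF that] of_bool_def ..
  have "sum ?f E = sum ?f ?D + sum ?f {a, b}"
    using assms by (intro sum.subset_diff) auto
  moreover have "sum ?f (?D \<union> {c, d}) = sum ?f ?D + sum ?f {c, d}"
    using assms by (intro sum.union_disjoint) auto
  moreover have "sum ?f {a, b} = of_bool (P a) + of_bool (P b)"
    "sum ?f {c, d} = of_bool (P c) + of_bool (P d)"
    using assms(6,7) by simp_all
  moreover have "card {e \<in> ?D \<union> {c, d}. P e} = sum ?f (?D \<union> {c, d})"
    using assms(1) by (intro c) simp
  ultimately show ?thesis using c[OF assms(1)] by linarith
qed

text \<open>Agrees with \<open>edge_connected k V E\<close> when \<open>V\<close> has at least two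
  vertices; for smaller \<open>V\<close> it holds vacuously, whereas
  \<open>edge_connectivity\<close> is then 0.\<close>

definition cuts_at_least :: "nat \<Rightarrow> 'a set \<Rightarrow> 'a set set \<Rightarrow> bool" where
  "cuts_at_least k V E \<longleftrightarrow> (\<forall>A. A \<noteq> {} \<longrightarrow> A \<subset> V \<longrightarrow> k \<le> num_between E A (V - A))"

text \<open>The members are sides, so each cut of size \<open>k\<close> appears twice, once for
  either side.\<close>

definition tight_cuts :: "nat \<Rightarrow> 'a set \<Rightarrow> 'a set set \<Rightarrow> 'a set set" where
  "tight_cuts k V E = {A. A \<noteq> {} \<and> A \<subset> V \<and> num_between E A (V - A) = k}"

lemma fewer_tight_cuts:
  assumes G: "simple_graph V E" and bip: "bipartition V E X Y"
    and deg: "\<forall>v\<in>V. \<delta> \<le> degree E v" and k: "k < \<delta>" "2 \<le> \<delta>"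
    and conn: "cuts_at_least k V E" and tight: "tight_cuts k V E \<noteq> {}"
  obtains E' where "simple_graph V E'" "bipartition V E' X Y" "degree E' = degree E"
    "cuts_at_least k V E'" "tight_cuts k V E' \<subset> tight_cuts k V E"
proof -
  have fin: "finite V" "finite E" using simple_graph_finite[OF G] by auto
  note conn' = conn[unfolded cuts_at_least_def, rule_format]
  obtain A where A: "A \<noteq> {}" "A \<subset> V" "num_between E A (V - A) = k"
    using tight by (auto simp: tight_cuts_def)
  obtain S where S: "atom V E k S" using atom_exists[OF G conn' A] by blast
  have SV: "S \<noteq> {}" "S \<subset> V" "num_between E S (V - S) = k" using S by (auto simp: atom_def)
  \<comment> \<open>The complement of \<open>S\<close> is a side of the same cut, hence contains an
    atom \<open>T\<close> disjoint from \<open>S\<close>.\<close>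
  have "num_between E (V - S) (V - (V - S)) = k"
    using SV by (simp add: double_diff edges_between_commute[of E "V - S" S])
  then obtain T where T: "T \<subseteq> V - S" "atom V E k T"
    using atom_exists[OF G conn', of "V - S"] SV by blast
  obtain x0 y0 where xy0: "x0 \<in> S" "y0 \<in> S" "{x0, y0} \<in> E"
    "num_between E {x0} (V - S) = 0" "num_between E {y0} (V - S) = 0"
    "\<And>C. C \<subseteq> S \<Longrightarrow> (x0 \<in> C) \<noteq> (y0 \<in> C) \<Longrightarrow> k + 3 \<le> 2 * num_between E C (S - C)"
    using atom_edge[OF G S deg k] by blast
  have ends: "\<exists>x\<in>X. \<exists>y\<in>Y. e = {x, y}" if "e \<in> E" for e
    using bip that by (simp add: bipartition_def)
  \<comment> \<open>Both edges are oriented from \<open>X\<close> to \<open>Y\<close>, so that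
    \<open>{x, v}\<close> and \<open>{u, y}\<close> respect the bipartition. What is known about
    \<open>x0\<close> and \<open>y0\<close> is symmetric in them.\<close>
  obtain x y where "x \<in> X" "y \<in> Y" and xy_eq: "{x0, y0} = {x, y}"
    using ends[OF xy0(3)] by auto
  then consider "x0 = x" "y0 = y" | "x0 = y" "y0 = x"
    by (auto simp: doubleton_eq_iff)
  then have "x \<in> S \<and> y \<in> S \<and> {x, y} \<in> E \<and>
    num_between E {x} (V - S) = 0 \<and> num_between E {y} (V - S) = 0 \<and>
    (\<forall>C. C \<subseteq> S \<longrightarrow> (x \<in> C) \<noteq> (y \<in> C) \<longrightarrow> k + 3 \<le> 2 * num_between E C (S - C))"
    using xy0 by cases (simp_all add: insert_commute)
  then have xy: "x \<in> S" "y \<in> S" "{x, y} \<in> E"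
    "num_between E {x} (V - S) = 0" "num_between E {y} (V - S) = 0"
    and split: "\<And>C. C \<subseteq> S \<Longrightarrow> (x \<in> C) \<noteq> (y \<in> C) \<Longrightarrow> k + 3 \<le> 2 * num_between E C (S - C)"
    by blast+
  obtain u0 v0 where uv0: "u0 \<in> T" "v0 \<in> T" "{u0, v0} \<in> E"
    using atom_edge[OF G T(2) deg k] by blast
  obtain u v where "u \<in> X" "v \<in> Y" and uv_eq: "{u0, v0} = {u, v}"
    using ends[OF uv0(3)] by auto
  have uv: "u \<in> T" "v \<in> T" "{u, v} \<in> E"
    using uv0 uv_eq by (auto simp: doubleton_eq_iff)
  have inV: "x \<in> V" "y \<in> V" "u \<in> V" "v \<in> V" "u \<notin> S" "v \<notin> S"
    using xy uv T SV by auto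
  have "X \<inter> Y = {}" using bip by (simp add: bipartition_def)
  then have dist: "x \<noteq> y" "u \<noteq> v" "x \<noteq> u" "x \<noteq> v" "y \<noteq> u" "y \<noteq> v"
    using \<open>x \<in> X\<close> \<open>y \<in> Y\<close> \<open>u \<in> X\<close> \<open>v \<in> Y\<close> xy inV by auto
  \<comment> \<open>\<open>x\<close> and \<open>y\<close> have no neighbours outside
    \<open>S\<close>, where \<open>u\<close> and \<open>v\<close> lie, so the switch creates no
    multiple edge.\<close>
  have "edges_between E {x} (V - S) = {}" "edges_between E {y} (V - S) = {}"
    using xy(4,5) fin(2) by (auto simp: edges_between_def)
  then have new: "{x, v} \<notin> E" "{u, y} \<notin> E"
    using inV unfolding edges_between_def by (auto simp: insert_commute)
  define E' where "E' = (E - {{x, y}, {u, v}}) \<union> {{x, v}, {u, y}}"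
  have count: "card {e \<in> E'. P e} + of_bool (P {x, y}) + of_bool (P {u, v}) =
    card {e \<in> E. P e} + of_bool (P {x, v}) + of_bool (P {u, y})" for P
    unfolding E'_def using fin(2) xy(3) uv(3) new dist
    by (intro card_exchange) (auto simp: doubleton_eq_iff)
  have G': "simple_graph V E'"
    using G inV dist unfolding simple_graph_def E'_def by auto
  have bip': "bipartition V E' X Y"
    using bip \<open>x \<in> X\<close> \<open>y \<in> Y\<close> \<open>u \<in> X\<close> \<open>v \<in> Y\<close>
    unfolding bipartition_def E'_def by blast
  have deg': "degree E' = degree E"
  proof
    fix w
    show "degree E' w = degree E w"
      using count[of "\<lambda>e. w \<in> e"] dist unfolding degree_def
      by (cases "w = x"; cases "w = y"; cases "w = u"; cases "w = v") simp_all
  qed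
  have cut': "num_between E' A (V - A) + of_bool ((x \<in> A) \<noteq> (y \<in> A)) + of_bool ((u \<in> A) \<noteq> (v \<in> A)) =
    num_between E A (V - A) + of_bool ((x \<in> A) \<noteq> (v \<in> A)) + of_bool ((u \<in> A) \<noteq> (y \<in> A))"
    if "A \<subset> V" for A
  proof -
    define P where "P e \<longleftrightarrow> (\<exists>c\<in>A. \<exists>d\<in>V - A. e = {c, d})" for e
    have P: "P {a, b} \<longleftrightarrow> (a \<in> A) \<noteq> (b \<in> A)" if "a \<in> V" "b \<in> V" for a b
      using that by (auto simp: P_def doubleton_eq_iff)
    have "edges_between F A (V - A) = {e \<in> F. P e}" for F
      by (simp add: edges_between_def P_def)
    then show ?thesis
      using count[of P] by (simp add: P inV)
  qed
  \<comment> \<open>The cut contains the disjoint splits of \<open>S\<close> and \<open>T\<close> by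
    \<open>A\<close>. Their doubled sizes are at least \<open>k + 3\<close> and
    \<open>k + 2\<close>, so the doubled sum is at least \<open>2 * k + 5\<close>, which integrality
    raises to \<open>2 * (k + 3)\<close>. The cut thus stays above \<open>k\<close> after losing
    2.\<close>
  have big: "k + 3 \<le> num_between E A (V - A)"
    if A: "A \<subseteq> V" "x \<in> A" "v \<in> A" "y \<notin> A" "u \<notin> A" for A
  proof -
    have "num_between E (A \<inter> S) (S - A) + num_between E (A \<inter> T) (T - A) \<le>
      num_between E (A \<inter> S) (V - A) + num_between E (A \<inter> T) (V - A)"
      using fin(2) SV T by (intro add_mono num_between_mono) auto
    also have "\<dots> = num_between E (A \<inter> S \<union> A \<inter> T) (V - A)"
      using T by (intro num_between_Un(1)[symmetric] fin(2)) auto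
    also have "\<dots> \<le> num_between E A (V - A)"
      using fin(2) by (intro num_between_mono) auto
    finally have "num_between E (A \<inter> S) (S - A) + num_between E (A \<inter> T) (T - A) \<le> num_between E A (V - A)" .
    moreover have "k + 3 \<le> 2 * num_between E (A \<inter> S) (S - A \<inter> S)"
      using A xy by (intro split) auto
    moreover have "k + 2 \<le> 2 * num_between E (A \<inter> T) (T - A \<inter> T)"
      using A uv by (intro atom_split[OF G T(2)]) auto
    moreover have "S - A \<inter> S = S - A" "T - A \<inter> T = T - A" by auto
    ultimately show ?thesis by simp
  qed
  \<comment> \<open>The old and new edges together form a 4-cycle, which every cut meets in an even
    number of edges. The size therefore drops only if both old edges cross and neither new one
    does.\<close>
  have mono: "num_between E A (V - A) \<le> num_between E' A (V - A) \<or> k < num_between E' A (V - A)"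
    if A: "A \<subset> V" for A
  proof (cases "(x \<in> A \<and> v \<in> A \<and> y \<notin> A \<and> u \<notin> A) \<or> (x \<notin> A \<and> v \<notin> A \<and> y \<in> A \<and> u \<in> A)")
    case True
    then have "k + 3 \<le> num_between E A (V - A)"
    proof
      assume "x \<notin> A \<and> v \<notin> A \<and> y \<in> A \<and> u \<in> A"
      then have "k + 3 \<le> num_between E (V - A) (V - (V - A))"
        using inV by (intro big) auto
      then show ?thesis using A by (simp add: double_diff edges_between_commute[of E "V - A" A])
    qed (use big A in auto)
    then show ?thesis using True cut'[OF A] by auto
  next
    case False
    then show ?thesis
      using cut'[OF A] by (cases "x \<in> A"; cases "y \<in> A"; cases "u \<in> A"; cases "v \<in> A") simp_all
  qed
  have step: "k \<le> num_between E' A (V - A) \<and>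
      (num_between E' A (V - A) = k \<longrightarrow> num_between E A (V - A) = k)"
    if "A \<noteq> {}" "A \<subset> V" for A
    using mono[OF that(2)] conn'[OF that] by linarith
  have "cuts_at_least k V E'"
    unfolding cuts_at_least_def using step by blast
  moreover have "tight_cuts k V E' \<subseteq> tight_cuts k V E"
    unfolding tight_cuts_def using step by blast
  moreover have "S \<in> tight_cuts k V E" using SV by (simp add: tight_cuts_def)
  \<comment> \<open>\<open>{x, y}\<close> lies inside \<open>S\<close> and \<open>{u, v}\<close>
    outside, while both new edges cross, so this cut now has size \<open>k + 2\<close>.\<close>
  moreover have "S \<notin> tight_cuts k V E'"
    using cut'[OF SV(2)] SV xy inV by (simp add: tight_cuts_def)
  ultimately show ?thesis using that G' bip' deg' by blast
qed

section \<open>Iterating the switch\<close>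

text \<open>Each switch shrinks the finite family of tight cuts and preserves the degrees and the
  bipartition; once the family is empty, every cut has size at least \<open>Suc k\<close>.\<close>

lemma raise_connectivity:
  assumes "simple_graph V E" "bipartition V E X Y" "\<forall>v\<in>V. \<delta> \<le> degree E v" "k < \<delta>" "2 \<le> \<delta>"
    and "cuts_at_least k V E"
  shows "\<exists>E'. simple_graph V E' \<and> bipartition V E' X Y \<and> degree E' = degree E \<and>
    cuts_at_least (Suc k) V E'"
  using assms
proof (induction "card (tight_cuts k V E)" arbitrary: E rule: less_induct)
  case less
  show ?case
  proof (cases "tight_cuts k V E = {}")
    case True
    then have "cuts_at_least (Suc k) V E"
      using less.prems(6) unfolding cuts_at_least_def tight_cuts_def
      by (metis (mono_tags, lifting) Suc_leI empty_iff le_neq_implies_less mem_Collect_eq)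
    then show ?thesis using less.prems by blast
  next
    case False
    obtain E' where E': "simple_graph V E'" "bipartition V E' X Y" "degree E' = degree E"
      "cuts_at_least k V E'" "tight_cuts k V E' \<subset> tight_cuts k V E"
      using fewer_tight_cuts[OF less.prems False] by blast
    have "finite (tight_cuts k V E)"
      by (rule finite_subset[of _ "Pow V"])
        (use simple_graph_finite[OF less.prems(1)] in \<open>auto simp: tight_cuts_def\<close>)
    then have "card (tight_cuts k V E') < card (tight_cuts k V E)"
      using E'(5) by (rule psubset_card_mono)
    then show ?thesis
      using less.hyps[of E'] E' less.prems by simp
  qed
qed

text \<open>The bound is raised one by one from the trivial value 0, so the initial graph may be
  disconnected; the first round makes it connected.\<close>

lemma same_degrees_connected:
  assumes "simple_graph V E" "bipartition V E X Y" "\<forall>v\<in>V. \<delta> \<le> degree E v" "2 \<le> \<delta>"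
    and "k \<le> \<delta>"
  shows "\<exists>E'. simple_graph V E' \<and> bipartition V E' X Y \<and> degree E' = degree E \<and>
    cuts_at_least k V E'"
  using assms(5)
proof (induction k)
  case 0
  have "cuts_at_least 0 V E" by (simp add: cuts_at_least_def)
  then show ?case using assms by blast
next
  case (Suc k)
  then obtain E' where E': "simple_graph V E'" "bipartition V E' X Y" "degree E' = degree E"
    "cuts_at_least k V E'" by auto
  then show ?case
    using raise_connectivity[OF E'(1,2) _ _ assms(4) E'(4)] assms(3) Suc.prems by simp
qed

theorem theorem2p5:
  fixes \<mu> :: nat and xs ys :: "nat list"
  assumes "\<mu> \<ge> 3"
    and "bipartite_graphic xs ys"
    and "\<forall>d \<in> set xs \<union> set ys. d > \<mu> - 1"
  shows "\<exists>(V :: nat set) E. realization V E xs ys \<and> edge_connected \<mu> V E"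
proof -
  obtain V :: "nat set" and E X Y where G: "simple_graph V E" and bip: "bipartition V E X Y"
    and seq: "bipartite_degree_sequence E X Y xs ys" and ne: "xs \<noteq> []" "ys \<noteq> []"
    using assms(2) unfolding bipartite_graphic_def realization_def by blast
  have V: "X \<union> Y = V" "X \<inter> Y = {}" using bip by (auto simp: bipartition_def)
  then have fin: "finite X" "finite Y" using simple_graph_finite[OF G] by auto
  have "set_mset (mset xs) = degree E ` X" "set_mset (mset ys) = degree E ` Y"
    using seq fin unfolding bipartite_degree_sequence_def by auto
  then have sets: "set xs = degree E ` X" "set ys = degree E ` Y" by simp_all
  have "degree E v \<in> set xs \<union> set ys" if "v \<in> V" for v
    using that sets V(1) by blast
  then have "\<forall>v\<in>V. \<mu> - 1 < degree E v" using assms(3) by blast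
  then have deg: "\<forall>v\<in>V. \<mu> \<le> degree E v" by fastforce
  have "X \<noteq> {}" "Y \<noteq> {}" using sets ne by auto
  then have "X \<subset> V" using V by blast
  \<comment> \<open>The infimum must range over a nonempty family, since \<open>Inf {}\<close> is 0
    on natural numbers; \<open>X\<close> itself is a member.\<close>
  with \<open>X \<noteq> {}\<close> have cuts: "{S. S \<noteq> {} \<and> S \<subset> V} \<noteq> {}" by blast
  obtain E' where E': "simple_graph V E'" "bipartition V E' X Y" "degree E' = degree E"
    "cuts_at_least \<mu> V E'"
    using same_degrees_connected[OF G bip deg, of \<mu>] assms(1) by auto
  have "realization V E' xs ys"
    using E'(1,2) seq unfolding realization_def bipartite_degree_sequence_def E'(3)[symmetric] by blast
  moreover have "edge_connected \<mu> V E'"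
    unfolding edge_connected_def edge_connectivity_def edge_cut_eq
    by (rule cINF_greatest[OF cuts]) (use E'(4) in \<open>simp add: cuts_at_least_def\<close>)
  ultimately show ?thesis by blast
qed

end
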